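(* For the Bradley--Terry model with four alternatives there are $20$ saturated designs (one for each $3$-element set of pairs, with weight $\frac13$ on each pair). Among those, $8$ have an empty region of optimality and $12$ have a non-empty region of optimality. The $12$ designs with non-empty region of optimality are exactly those whose graph representation is one of the $12$ labelings of the path $P_4$ on the vertex set $\{1,2,3,4\}$. The region of optimality of the design on the path $(1,2),(2,3),(3,4)$ is the set of all $\beta\in\mathbb{R}^3$ such that $$\lambda_{13}(\lambda_{12}+\lambda_{23})-\lambda_{12}\lambda_{23}\le 0,$$ $$\lambda_{24}(\lambda_{23}+\lambda_{34})-\lambda_{23}\lambda_{34}\le 0,$$ $$\lambda_{14}(\lambda_{12}\lambda_{23}+\lambda_{12}\lambda_{34}+\lambda_{23}\lambda_{34})-\lambda_{12}\lambda_{23}\lambda_{34}\le 0.$$ The regions of optimality for the other paths arise from this by relabeling: for a permutation $\sigma$ of $\{1,2,3,4\}$, the region of optimality of the design on the path $\sigma(1),\sigma(2),\sigma(3),\sigma(4)$ is given by the inequalities obtained by replacing each $\lambda_{ij}$ with $\lambda_{\sigma(i)\sigma(j)}$.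
   Context: Bradley--Terry model with $m=4$ alternatives. The parameters are $\beta=(\beta_1,\beta_2,\beta_3)^T\in\mathbb{R}^{3}$, with the convention $\beta_4=0$. With $e_1,e_2,e_3$ the standard unit vectors of $\mathbb{R}^3$, the regression vectors are $f(i,j)=e_i-e_j$ for $1\le i<j\le 3$ and $f(i,4)=e_i$ for $1\le i\le 3$. The intensity is $\lambda_{ij}=\lambda_{ij}(\beta)=\dfrac{e^{\beta_i-\beta_j}}{(1+e^{\beta_i-\beta_j})^2}$, which satisfies $\lambda_{ij}=\lambda_{ji}$. A design $\xi$ is an assignment of a real weight $w_{ij}\ge 0$ to each pair $(i,j)$ with $1\le i<j\le 4$ such that $\sum_{i<j}w_{ij}=1$. The information matrix is $M(\xi,\beta)=\sum_{i<j}w_{ij}\lambda_{ij}f(i,j)f(i,j)^T\in\mathbb{R}^{3\times 3}$. A design $\xi^*$ is locally $D$-optimal for $\beta$ if $\log\det M(\xi^*,\beta)\ge\log\det M(\xi,\beta)$ for all designs $\xi$ (with $\log 0=-\infty$). The region of optimality of a design is the set of $\beta\in\mathbb{R}^3$ for which it is locally $D$-optimal. A design is saturated if its support $\{(i,j):w_{ij}>0\}$ has exactly $3$ elements; since locally $D$-optimal saturated designs necessarily have equal weights, saturated designs are here taken to have weights $\frac13$ on the three support pairs and are identified with their supports. The graph representation of a design is the undirected simple graph with vertex set $\{1,2,3,4\}$ whose edges are the pairs with positive weight. A path is a tree in which every vertex is connected to at most two other vertices. *)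

theory Defs
  imports
    "HOL-Analysis.Analysis"
    "HOL-Combinatorics.Permutations"
    "Graph_Theory.Graph_Theory"
begin

text \<open>The alternatives are the natural numbers 1, 2, 3, 4.\<close>

definition pairs :: "(nat \<times> nat) set" where
  "pairs = {(i, j). 1 \<le> i \<and> i < j \<and> j \<le> 4}"

text \<open>
  The index type \<^typ>\<open>3\<close> has arithmetic modulo 3, so the last alternative, whose parameter is
  fixed to 0, must be treated separately: \<open>of_nat 4 = (1 :: 3)\<close>.
\<close>

definition par :: "real^3 \<Rightarrow> nat \<Rightarrow> real" where
  "par \<beta> i = (if i = 4 then 0 else \<beta> $ of_nat i)"

definition intensity :: "real^3 \<Rightarrow> nat \<Rightarrow> nat \<Rightarrow> real" where
  "intensity \<beta> i j = exp (par \<beta> i - par \<beta> j) / (1 + exp (par \<beta> i - par \<beta> j))\<^sup>2"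

definition regvec :: "nat \<Rightarrow> nat \<Rightarrow> real^3" where
  "regvec i j = (if j = 4 then axis (of_nat i) 1 else axis (of_nat i) 1 - axis (of_nat j) 1)"

text \<open>
  A design is a weight function on \<^const>\<open>pairs\<close>. It is required to vanish elsewhere so that
  designs can be compared and counted as functions.
\<close>

definition is_design :: "(nat \<times> nat \<Rightarrow> real) \<Rightarrow> bool" where
  "is_design w \<longleftrightarrow> (\<forall>p\<in>pairs. 0 \<le> w p) \<and> (\<forall>p. p \<notin> pairs \<longrightarrow> w p = 0) \<and> (\<Sum>p\<in>pairs. w p) = 1"

definition support :: "(nat \<times> nat \<Rightarrow> real) \<Rightarrow> (nat \<times> nat) set" where
  "support w = {p \<in> pairs. 0 < w p}"

definition info_matrix :: "(nat \<times> nat \<Rightarrow> real) \<Rightarrow> real^3 \<Rightarrow> real^3^3" where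
  "info_matrix w \<beta> = (\<Sum>(i, j)\<in>pairs. (w (i, j) * intensity \<beta> i j) *\<^sub>R
     ((columnvector (regvec i j) :: real^1^3) ** (rowvector (regvec i j) :: real^3^1)))"

text \<open>
  The logarithm with \<open>log 0 = -\<infinity>\<close>. Information matrices of designs are positive semidefinite,
  so negative arguments do not arise.
\<close>

definition log_ereal :: "real \<Rightarrow> ereal" where
  "log_ereal x = (if x \<le> 0 then -\<infinity> else ereal (ln x))"

definition locally_D_optimal :: "(nat \<times> nat \<Rightarrow> real) \<Rightarrow> real^3 \<Rightarrow> bool" where
  "locally_D_optimal w \<beta> \<longleftrightarrow> is_design w \<and>
     (\<forall>v. is_design v \<longrightarrow> log_ereal (det (info_matrix v \<beta>)) \<le> log_ereal (det (info_matrix w \<beta>)))"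

definition optimality_region :: "(nat \<times> nat \<Rightarrow> real) \<Rightarrow> (real^3) set" where
  "optimality_region w = {\<beta>. locally_D_optimal w \<beta>}"

definition saturated_designs :: "(nat \<times> nat \<Rightarrow> real) set" where
  "saturated_designs = {w. is_design w \<and> card (support w) = 3 \<and> (\<forall>p\<in>support w. w p = 1/3)}"

definition design_on :: "(nat \<times> nat) set \<Rightarrow> (nat \<times> nat \<Rightarrow> real)" where
  "design_on S = (\<lambda>p. if p \<in> S then 1/3 else 0)"

text \<open>Undirected simple graphs are represented as symmetric loop-free relations
  (locale \<^locale>\<open>pair_graph\<close>).\<close>

definition graph_rep :: "(nat \<times> nat \<Rightarrow> real) \<Rightarrow> nat pair_pre_digraph" where
  "graph_rep w = \<lparr>pverts = {1..4}, parcs = support w \<union> (support w)\<inverse>\<rparr>"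

text \<open>
  The library's \<^const>\<open>tree\<close> is unsuitable here: in a symmetric digraph, traversing an edge back and
  forth counts as a \<^const>\<open>pre_digraph.cycle\<close>. A cycle of an undirected simple graph has at
  least three edges.
\<close>

definition is_tree :: "'a pair_pre_digraph \<Rightarrow> bool" where
  "is_tree G \<longleftrightarrow> Digraph_Component.connected (with_proj G) \<and>
     \<not> (\<exists>c. pre_digraph.cycle (with_proj G) c \<and> 3 \<le> length c)"

definition is_path :: "'a pair_pre_digraph \<Rightarrow> bool" where
  "is_path G \<longleftrightarrow> is_tree G \<and> (\<forall>v\<in>pverts G. out_degree (with_proj G) v \<le> 2)"

definition labeled_paths :: "nat pair_pre_digraph set" where
  "labeled_paths = {G. pair_graph G \<and> pverts G = {1..4} \<and> is_path G}"

definition ordered_pair :: "nat \<Rightarrow> nat \<Rightarrow> nat \<times> nat" where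
  "ordered_pair i j = (min i j, max i j)"

definition path_design :: "(nat \<Rightarrow> nat) \<Rightarrow> (nat \<times> nat \<Rightarrow> real)" where
  "path_design \<sigma> = design_on
     {ordered_pair (\<sigma> 1) (\<sigma> 2), ordered_pair (\<sigma> 2) (\<sigma> 3), ordered_pair (\<sigma> 3) (\<sigma> 4)}"

end

theory Submission
  imports Defs
begin

text \<open>
  By the matrix-tree theorem the determinant of the information matrix is the sum, over the 16
  spanning trees of the complete graph on the alternatives, of the products of the edge weights
  \<open>w\<^sub>i\<^sub>j \<lambda>\<^sub>i\<^sub>j\<close> (\<open>det_info_matrix\<close>). This form is symmetric in the four alternatives, although
  the parametrization singles out the last one, so every argument below is carried out once, for
  an arbitrary labelling \<open>i, j, k, l\<close> of the alternatives; this also gives the relabelled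
  regions.

  Let a saturated design be supported on a spanning tree, and shift a small weight \<open>e\<close> to an edge
  outside the tree. This edge closes a cycle, and the determinant changes by the factor
  \<open>(1 - e)\<^sup>2 (1 - e + 3 e r)\<close>, where \<open>r\<close> is the intensity of the new edge times the sum of the
  reciprocal intensities along the tree path that joins its ends. The derivative at \<open>e = 0\<close> is
  \<open>3 r - 3\<close>, so optimality forces \<open>r \<le> 1\<close> (\<open>exchange_bound\<close>). For a path these conditions are
  the three displayed inequalities. Conversely, in the basis of the path edges the information
  matrix of any design is a sum of matrices with nonnegative entries, and its determinant is at
  most the product of its diagonal entries, one for each cut that deletes a path edge
  (\<open>spanning_tree_sum_le_cuts\<close>). After scaling by the intensities of the path edges, the
  inequalities bound the trace, and the inequality of arithmetic and geometric means gives
  the optimal value (\<open>path_inequalities_imp_det_le\<close>).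

  The inequalities hold when the parameters along the path are sufficiently spread out and equally
  spaced, so no path has an empty region. For a star, the condition for two leaves says that
  they are farther apart than either is from the centre, because the intensity decreases with
  the distance of the parameters. Hence any two leaves lie on opposite sides of the centre, which
  is impossible for three leaves. A triangle misses one alternative, so its information matrix is
  singular.

  A set of three pairs that is neither a star nor a triangle is a path. The same elementary
  criterion (\<open>path_of_relation\<close>) identifies the graphs that are paths with these designs. There are
  \<open>6 choose 3 = 20\<close> sets of three pairs, four stars and four triangles, which leaves 12 paths.
\<close>

section \<open>Pairs and labellings\<close>

lemma ordered_pair_eq_iff:
  "ordered_pair i j = ordered_pair k l \<longleftrightarrow> (i = k \<and> j = l) \<or> (i = l \<and> j = k)"
  by (auto simp: ordered_pair_def min_def max_def)

lemma ordered_pair_mem_pairs: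
  "ordered_pair i j \<in> pairs \<longleftrightarrow> i \<noteq> j \<and> i \<in> {1..4} \<and> j \<in> {1..4}"
  by (auto simp: ordered_pair_def pairs_def min_def max_def)

lemma pairs_eq: "pairs = {(1,2), (1,3), (1,4), (2,3), (2,4), (3,4)}"
  by (auto simp: pairs_def)

lemma card_pairs: "card pairs = 6" and finite_pairs: "finite pairs"
  by (simp_all add: pairs_eq)

text \<open>
  The equation \<open>{i, j, k, l} = {1..4}\<close> is used throughout to say that \<open>i, j, k, l\<close> is a labelling of
  the alternatives: four elements can only fill a set of size four if they are distinct.
\<close>

lemma labelling_distinct:
  assumes "{i, j, k, l} = {1..4::nat}"
  shows "i \<noteq> j" "i \<noteq> k" "i \<noteq> l" "j \<noteq> k" "j \<noteq> l" "k \<noteq> l"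
proof -
  have "card (set [i, j, k, l]) = length [i, j, k, l]"
    using arg_cong[OF assms, of card] by simp
  then have "distinct [i, j, k, l]"
    by (rule card_distinct)
  then show "i \<noteq> j" "i \<noteq> k" "i \<noteq> l" "j \<noteq> k" "j \<noteq> l" "k \<noteq> l"
    by auto
qed

text \<open>
  Adjacent transpositions generate the symmetric group. As rewrite rules they sort the four
  arguments, which is how the proof uses them.
\<close>

lemma labelling_invariant:
  assumes swaps: "\<And>i j k l. T j i k l = T i j k l" "\<And>i j k l. T i k j l = T i j k l"
      "\<And>i j k l. T i j l k = T i j k l"
    and lab: "{i, j, k, l} = {1..4::nat}"
  shows "T 1 2 3 4 = T i j k l"
proof -
  have "x = 1 \<or> x = 2 \<or> x = 3 \<or> x = 4" if "x \<in> {i, j, k, l}" for x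
    using that unfolding lab by auto
  then have "i = 1 \<or> i = 2 \<or> i = 3 \<or> i = 4" "j = 1 \<or> j = 2 \<or> j = 3 \<or> j = 4"
    "k = 1 \<or> k = 2 \<or> k = 3 \<or> k = 4" "l = 1 \<or> l = 2 \<or> l = 3 \<or> l = 4"
    by blast+
  then show ?thesis
    using labelling_distinct[OF lab]
    by (elim disjE) (simp_all only: refl not_True_eq_False FalseE simp_thms swaps)
qed

lemma pairs_labelling:
  assumes "{i, j, k, l} = {1..4::nat}"
  shows "pairs = {ordered_pair i j, ordered_pair j k, ordered_pair k l,
    ordered_pair i k, ordered_pair j l, ordered_pair i l}"
proof -
  let ?E = "{ordered_pair i j, ordered_pair j k, ordered_pair k l,
    ordered_pair i k, ordered_pair j l, ordered_pair i l}"
  have "i \<in> {1..4}" "j \<in> {1..4}" "k \<in> {1..4}" "l \<in> {1..4}"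
    using assms by auto
  then have "?E \<subseteq> pairs"
    using labelling_distinct[OF assms] by (auto simp: ordered_pair_mem_pairs)
  moreover have "card ?E = 6"
    using labelling_distinct[OF assms] by (auto simp: ordered_pair_eq_iff)
  ultimately have "?E = pairs"
    by (intro card_subset_eq[OF finite_pairs]) (simp_all only: card_pairs)
  then show ?thesis
    by (rule sym)
qed

lemma sum_pairs_labelling:
  fixes f :: "nat \<times> nat \<Rightarrow> real"
  assumes "{i, j, k, l} = {1..4::nat}"
  shows "(\<Sum>p\<in>pairs. f p) = f (ordered_pair i j) + f (ordered_pair j k) + f (ordered_pair k l)
    + f (ordered_pair i k) + f (ordered_pair j l) + f (ordered_pair i l)"
  unfolding pairs_labelling[OF assms]
  using labelling_distinct[OF assms] by (simp add: ordered_pair_eq_iff)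

section \<open>Intensities\<close>

lemma intensity_pos: "0 < intensity \<beta> i j"
proof -
  have "0 < 1 + exp (par \<beta> i - par \<beta> j)"
    by (simp add: add_pos_pos)
  then show ?thesis
    by (simp add: intensity_def)
qed

text \<open>
  This form shows at once that the intensity depends only on the distance of the two
  parameters, and that it decreases with it.
\<close>

lemma intensity_cosh: "intensity \<beta> i j = 1 / (2 + 2 * cosh (par \<beta> i - par \<beta> j))"
proof -
  define d where "d = par \<beta> i - par \<beta> j"
  have "0 < exp d"
    by simp
  then have "exp d / (1 + exp d)\<^sup>2 = 1 / (2 + (exp d + inverse (exp d)))"
    by (simp add: field_simps power2_eq_square)
  then show ?thesis
    by (simp add: intensity_def cosh_def exp_minus flip: d_def)
qed

lemma intensity_sym: "intensity \<beta> i j = intensity \<beta> j i"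
  using cosh_minus[of "par \<beta> i - par \<beta> j"] by (simp add: intensity_cosh)

lemma intensity_mono:
  assumes "\<bar>par \<beta> i - par \<beta> j\<bar> \<le> \<bar>par \<beta> k - par \<beta> l\<bar>"
  shows "intensity \<beta> k l \<le> intensity \<beta> i j"
proof -
  have "cosh (par \<beta> i - par \<beta> j) \<le> cosh (par \<beta> k - par \<beta> l)"
    using assms cosh_real_nonneg_le_iff[of "\<bar>par \<beta> i - par \<beta> j\<bar>" "\<bar>par \<beta> k - par \<beta> l\<bar>"]
    by (simp add: cosh_real_abs)
  moreover have "0 < cosh (par \<beta> i - par \<beta> j)"
    by simp
  ultimately show ?thesis
    unfolding intensity_cosh by (intro divide_left_mono mult_pos_pos) linarith+
qed

section \<open>The determinant of the information matrix\<close>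

text \<open>
  The spanning trees of the complete graph on four vertices are the 4 stars (first line) and the
  12 paths. The function \<open>A\<close> gives the weights of the edges and is meant to be symmetric.
\<close>

definition spanning_tree_sum :: "(nat \<Rightarrow> nat \<Rightarrow> real) \<Rightarrow> nat \<Rightarrow> nat \<Rightarrow> nat \<Rightarrow> nat \<Rightarrow> real" where
  "spanning_tree_sum A i j k l =
     A i j * A i k * A i l + A i j * A j k * A j l + A i k * A j k * A k l + A i l * A j l * A k l
     + A i j * A j k * A k l + A i j * A j l * A k l + A i k * A j k * A j l
     + A i k * A k l * A j l + A i l * A j l * A j k + A i l * A k l * A j k
     + A i j * A i k * A j l + A i j * A i k * A k l + A i j * A i l * A j k
     + A i j * A i l * A k l + A i k * A i l * A j k + A i k * A i l * A j l"

definition edge_weight :: "(nat \<times> nat \<Rightarrow> real) \<Rightarrow> real^3 \<Rightarrow> nat \<Rightarrow> nat \<Rightarrow> real" where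
  "edge_weight w \<beta> i j = w (ordered_pair i j) * intensity \<beta> i j"

lemma spanning_tree_sum_swaps:
  assumes sym: "\<And>x y. A x y = A y x"
  shows "spanning_tree_sum A j i k l = spanning_tree_sum A i j k l"
    and "spanning_tree_sum A i k j l = spanning_tree_sum A i j k l"
    and "spanning_tree_sum A i j l k = spanning_tree_sum A i j k l"
  unfolding spanning_tree_sum_def sym[of j i] sym[of k j] sym[of l k] by algebra+

lemma spanning_tree_sum_labelling:
  assumes sym: "\<And>x y. A x y = A y x" and lab: "{i, j, k, l} = {1..4::nat}"
  shows "spanning_tree_sum A 1 2 3 4 = spanning_tree_sum A i j k l"
  using spanning_tree_sum_swaps[of A, OF sym] lab by (rule labelling_invariant)

lemma info_matrix_nth:
  "info_matrix w \<beta> $ a $ b =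
    (\<Sum>(i, j)\<in>pairs. w (i, j) * intensity \<beta> i j * (regvec i j $ a * regvec i j $ b))"
  by (simp add: info_matrix_def case_prod_beta matrix_matrix_mult_def columnvector_def
      rowvector_def)

text \<open>
  The information matrix is the weighted Laplacian of the complete graph without the row and the
  column of alternative 4, so this is the matrix-tree theorem for four vertices.
\<close>

lemma det_info_matrix_standard:
  "det (info_matrix w \<beta>) = spanning_tree_sum (edge_weight w \<beta>) 1 2 3 4"
proof -
  define A where "A = edge_weight w \<beta>"
  \<comment> \<open>the entries are evaluated with the weights as atoms\<close>
  have w: "w (1,2) * intensity \<beta> 1 2 = A 1 2" "w (1,3) * intensity \<beta> 1 3 = A 1 3"
    "w (1,4) * intensity \<beta> 1 4 = A 1 4" "w (2,3) * intensity \<beta> 2 3 = A 2 3"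
    "w (2,4) * intensity \<beta> 2 4 = A 2 4" "w (3,4) * intensity \<beta> 3 4 = A 3 4"
    by (simp_all add: A_def edge_weight_def ordered_pair_def numeral_eq_Suc)
  have r: "regvec 1 2 = axis 1 1 - axis 2 1" "regvec 1 3 = axis 1 1 - axis 3 1"
    "regvec 2 3 = axis 2 1 - axis 3 1" "regvec 1 4 = axis 1 1"
    "regvec 2 4 = axis 2 1" "regvec 3 4 = axis 3 1"
    by (simp_all add: regvec_def)
  have d: "(1::3) \<noteq> 2" "(1::3) \<noteq> 3" "(2::3) \<noteq> 1" "(2::3) \<noteq> 3" "(3::3) \<noteq> 1" "(3::3) \<noteq> 2"
    by simp_all
  have entry: "info_matrix w \<beta> $ a $ b =
      A 1 2 * (regvec 1 2 $ a * regvec 1 2 $ b) + A 1 3 * (regvec 1 3 $ a * regvec 1 3 $ b)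
      + A 1 4 * (regvec 1 4 $ a * regvec 1 4 $ b) + A 2 3 * (regvec 2 3 $ a * regvec 2 3 $ b)
      + A 2 4 * (regvec 2 4 $ a * regvec 2 4 $ b) + A 3 4 * (regvec 3 4 $ a * regvec 3 4 $ b)" for a b
    unfolding info_matrix_nth pairs_eq by (simp add: w del: One_nat_def)
  have entries: "info_matrix w \<beta> $ 1 $ 1 = A 1 2 + A 1 3 + A 1 4"
    "info_matrix w \<beta> $ 2 $ 2 = A 1 2 + A 2 3 + A 2 4"
    "info_matrix w \<beta> $ 3 $ 3 = A 1 3 + A 2 3 + A 3 4"
    "info_matrix w \<beta> $ 1 $ 2 = - A 1 2" "info_matrix w \<beta> $ 2 $ 1 = - A 1 2"
    "info_matrix w \<beta> $ 1 $ 3 = - A 1 3" "info_matrix w \<beta> $ 3 $ 1 = - A 1 3"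
    "info_matrix w \<beta> $ 2 $ 3 = - A 2 3" "info_matrix w \<beta> $ 3 $ 2 = - A 2 3"
    unfolding entry r by (simp_all add: axis_def d)
  show ?thesis
    unfolding det_3 A_def[symmetric] spanning_tree_sum_def entries by algebra
qed

text \<open>
  The convention that the parameter of alternative 4 is 0 thus leaves no trace in the determinant,
  and any labelling may be used to expand it.
\<close>

lemma det_info_matrix:
  assumes "{i, j, k, l} = {1..4::nat}"
  shows "det (info_matrix w \<beta>) = spanning_tree_sum (edge_weight w \<beta>) i j k l"
proof -
  have "edge_weight w \<beta> x y = edge_weight w \<beta> y x" for x y
    using intensity_sym[of \<beta> x y] by (simp add: edge_weight_def ordered_pair_def min.commute max.commute)
  then show ?thesis
    unfolding det_info_matrix_standard by (rule spanning_tree_sum_labelling[OF _ assms])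
qed

section \<open>Auxiliary inequalities\<close>

lemma log_ereal_le_iff: "0 < y \<Longrightarrow> log_ereal x \<le> log_ereal y \<longleftrightarrow> x \<le> y"
  by (auto simp: log_ereal_def)

lemma log_ereal_mono: "x \<le> y \<Longrightarrow> log_ereal x \<le> log_ereal y"
  by (auto simp: log_ereal_def)

text \<open>
  The difference of the two sides is a combination of squares with nonnegative coefficients.
\<close>

lemma geometric_mean_3:
  fixes x y z :: real
  assumes "0 \<le> x" "0 \<le> y" "0 \<le> z"
  shows "27 * (x * y * z) \<le> (x + y + z) ^ 3"
proof -
  have "2 * ((x + y + z) ^ 3 - 27 * (x * y * z)) =
      (x + y + z) * ((x - y)\<^sup>2 + (y - z)\<^sup>2 + (z - x)\<^sup>2)
      + 6 * (x * (y - z)\<^sup>2 + y * (z - x)\<^sup>2 + z * (x - y)\<^sup>2)"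
    by (simp add: power2_eq_square power3_eq_cube algebra_simps)
  also have "\<dots> \<ge> 0"
    using assms by (intro add_nonneg_nonneg mult_nonneg_nonneg) auto
  finally show ?thesis
    by simp
qed

text \<open>
  Deleting one edge of the path \<open>i, j, k, l\<close> cuts the vertices into two sets, and the three factors
  are the weights across these cuts. They are the diagonal entries of the information matrix in
  the basis of the path edges, so this is Hadamard's inequality. Here it holds monomial by
  monomial.
\<close>

lemma spanning_tree_sum_le_cuts:
  assumes "\<And>x y. 0 \<le> A x y"
  shows "spanning_tree_sum A i j k l \<le>
    (A i j + A i k + A i l) * (A j k + A i k + A j l + A i l) * (A k l + A j l + A i l)"
proof -
  have "(A i j + A i k + A i l) * (A j k + A i k + A j l + A i l) * (A k l + A j l + A i l)
      - spanning_tree_sum A i j k l =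
      A i j * A j l * A j l + 2 * A i j * A j l * A i l + A i j * A i l * A i l
      + A j k * A i l * A i l + A k l * A i k * A i k + 2 * A k l * A i k * A i l
      + A k l * A i l * A i l + A i k * A i k * A j l + A i k * A i k * A i l
      + A i k * A j l * A j l + 2 * A i k * A j l * A i l + 2 * A i k * A i l * A i l
      + A j l * A j l * A i l + 2 * A j l * A i l * A i l + A i l * A i l * A i l"
    unfolding spanning_tree_sum_def by algebra
  also have "\<dots> \<ge> 0"
    using assms by (intro add_nonneg_nonneg mult_nonneg_nonneg) auto
  finally show ?thesis
    by simp
qed

section \<open>Saturated designs and the exchange of weight\<close>

lemma design_on_is_design:
  assumes "S \<subseteq> pairs" "card S = 3"
  shows "is_design (design_on S)"
proof -
  have "(\<Sum>p\<in>pairs. design_on S p) = (\<Sum>p\<in>S. 1/3)"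
    using assms(1) finite_pairs by (simp add: design_on_def sum.If_cases Int_absorb1)
  then show ?thesis
    using assms by (auto simp: is_design_def design_on_def)
qed

definition exchange_design :: "(nat \<times> nat) set \<Rightarrow> nat \<times> nat \<Rightarrow> real \<Rightarrow> (nat \<times> nat \<Rightarrow> real)" where
  "exchange_design S p e = (\<lambda>q. (1 - e) * design_on S q + (if q = p then e else 0))"

lemma exchange_design_is_design:
  assumes "S \<subseteq> pairs" "card S = 3" "p \<in> pairs" "0 \<le> e" "e \<le> 1"
  shows "is_design (exchange_design S p e)"
  using design_on_is_design[OF assms(1,2)] assms(3-5) finite_pairs
  by (auto simp: is_design_def exchange_design_def sum.distrib simp flip: sum_distrib_left)

text \<open>
  If \<open>P < Q\<close>, the left-hand side increases at \<open>e = 0\<close>, where it equals \<open>P / 27\<close>. In the application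
  \<open>P\<close> is the product of the intensities of a spanning tree, and \<open>Q\<close> the sum of the products for the
  three-edge trees obtained by exchanging one tree edge for the new edge.
\<close>

lemma exchange_bound:
  fixes P Q :: real
  assumes "0 < P"
    and *: "\<And>e. 0 \<le> e \<Longrightarrow> e < 1 \<Longrightarrow> (1 - e)\<^sup>2 * ((1 - e) * P / 27 + e * Q / 9) \<le> P / 27"
  shows "Q \<le> P"
proof (rule ccontr)
  assume "\<not> Q \<le> P"
  then have "P < Q" by simp
  \<comment> \<open>small enough to keep the sign that the derivative has at 0\<close>
  define e where "e = (Q - P) / (2 * Q)"
  have e: "0 < e" "e < 1" "2 * Q * e = Q - P"
    using \<open>0 < P\<close> \<open>P < Q\<close> by (auto simp: e_def field_simps)
  have "27 * ((1 - e)\<^sup>2 * ((1 - e) * P / 27 + e * Q / 9)) - P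
      = e * (3 * (Q - P) - 3 * (2 * Q * e) + 3 * P * e + (3 * Q - P) * e\<^sup>2)"
    by (simp add: power2_eq_square field_simps)
  also have "\<dots> = e * (3 * P * e + (3 * Q - P) * e\<^sup>2)"
    by (simp add: e)
  also have "\<dots> > 0"
    using e \<open>0 < P\<close> \<open>P < Q\<close> by (intro mult_pos_pos add_pos_pos) auto
  finally show False
    using *[of e] e by simp
qed

lemma optimal_exchange:
  assumes "S \<subseteq> pairs" "card S = 3" "p \<in> pairs" "0 < P"
    and det: "\<And>e. det (info_matrix (exchange_design S p e) \<beta>) =
      ((1 - e) / 3)\<^sup>2 * ((1 - e) / 3 * P + e * Q)"
    and opt: "locally_D_optimal (design_on S) \<beta>"
  shows "Q \<le> P"
proof (rule exchange_bound[OF \<open>0 < P\<close>])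
  fix e :: real
  assume "0 \<le> e" "e < 1"
  have "exchange_design S p 0 = design_on S"
    by (auto simp: exchange_design_def)
  then have "det (info_matrix (design_on S) \<beta>) = P / 27"
    using det[of 0] by (simp add: power2_eq_square)
  moreover have "is_design (exchange_design S p e)"
    using exchange_design_is_design assms(1-3) \<open>0 \<le> e\<close> \<open>e < 1\<close> by simp
  then have "log_ereal (det (info_matrix (exchange_design S p e) \<beta>))
      \<le> log_ereal (det (info_matrix (design_on S) \<beta>))"
    using opt by (simp add: locally_D_optimal_def)
  ultimately show "(1 - e)\<^sup>2 * ((1 - e) * P / 27 + e * Q / 9) \<le> P / 27"
    using \<open>0 < P\<close> by (simp add: det log_ereal_le_iff power2_eq_square field_simps)
qed

lemma labelling_ordered_pair:
  assumes "{i, j, k, l} = {1..4::nat}"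
  shows "ordered_pair i j \<in> pairs" "ordered_pair j k \<in> pairs" "ordered_pair k l \<in> pairs"
    "ordered_pair i k \<in> pairs" "ordered_pair j l \<in> pairs" "ordered_pair i l \<in> pairs"
  using pairs_labelling[OF assms] by auto

lemma ordered_pair_commute: "ordered_pair i j = ordered_pair j i"
  by (simp add: ordered_pair_eq_iff)

text \<open>
  The exchange argument for a tree that consists of the path \<open>i, j, k\<close> and a pendant edge at any of
  its vertices; the new edge closes a triangle. It applies to both ends of a path (\<open>m = k\<close> and,
  after relabelling, the other end) and to a star (\<open>m = j\<close>).
\<close>

lemma optimal_triangle_inequality:
  assumes lab: "{i, j, k, l} = {1..4::nat}" and m: "m \<in> {i, j, k}"
    and opt: "locally_D_optimal
      (design_on {ordered_pair i j, ordered_pair j k, ordered_pair m l}) \<beta>"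
  shows "intensity \<beta> i k * (intensity \<beta> i j + intensity \<beta> j k)
    \<le> intensity \<beta> i j * intensity \<beta> j k"
proof -
  note d = labelling_distinct[OF lab] labelling_distinct[OF lab, symmetric]
  let ?S = "{ordered_pair i j, ordered_pair j k, ordered_pair m l}"
  let ?l = "intensity \<beta>"
  have "?l i k * (?l i j + ?l j k) * ?l m l \<le> ?l i j * ?l j k * ?l m l"
  proof (rule optimal_exchange[OF _ _ _ _ _ opt])
    show "?S \<subseteq> pairs" "ordered_pair i k \<in> pairs"
      using labelling_ordered_pair[OF lab] m by auto
    show "card ?S = 3"
      using d m by (auto simp: ordered_pair_eq_iff)
    show "0 < ?l i j * ?l j k * ?l m l"
      by (simp add: intensity_pos)
    show "det (info_matrix (exchange_design ?S (ordered_pair i k) e) \<beta>) =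
        ((1 - e) / 3)\<^sup>2 * ((1 - e) / 3 * (?l i j * ?l j k * ?l m l)
        + e * (?l i k * (?l i j + ?l j k) * ?l m l))" for e
    proof -
      define t where "t = (1 - e) / 3"
      define A where "A = edge_weight (exchange_design ?S (ordered_pair i k) e) \<beta>"
      have A: "A i j = t * ?l i j" "A j k = t * ?l j k" "A i k = e * ?l i k"
        "A i l = (if m = i then t * ?l m l else 0)" "A j l = (if m = j then t * ?l m l else 0)"
        "A k l = (if m = k then t * ?l m l else 0)"
        using m by (elim insertE emptyE; simp add: d A_def t_def edge_weight_def
            exchange_design_def design_on_def ordered_pair_eq_iff)+
      have "spanning_tree_sum A i j k l = t\<^sup>2 * (t * (?l i j * ?l j k * ?l m l)
          + e * (?l i k * (?l i j + ?l j k) * ?l m l))"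
        using m unfolding spanning_tree_sum_def A
        by (elim insertE emptyE) (simp_all add: d power2_eq_square algebra_simps)
      then show ?thesis
        unfolding det_info_matrix[OF lab] A_def t_def .
    qed
  qed
  then show ?thesis
    using intensity_pos[of \<beta> m l] by (simp add: mult_le_cancel_right)
qed

definition path_edges :: "nat \<Rightarrow> nat \<Rightarrow> nat \<Rightarrow> nat \<Rightarrow> (nat \<times> nat) set" where
  "path_edges i j k l = {ordered_pair i j, ordered_pair j k, ordered_pair k l}"

lemma path_edges_subset_card:
  assumes "{i, j, k, l} = {1..4::nat}"
  shows "path_edges i j k l \<subseteq> pairs" "card (path_edges i j k l) = 3"
  using labelling_ordered_pair[OF assms] labelling_distinct[OF assms]
  by (auto simp: path_edges_def ordered_pair_eq_iff)

text \<open>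
  The exchange argument for the edge that joins the ends of a path and closes a 4-cycle.
\<close>

lemma optimal_four_cycle_inequality:
  assumes lab: "{i, j, k, l} = {1..4::nat}"
    and opt: "locally_D_optimal (design_on (path_edges i j k l)) \<beta>"
  shows "intensity \<beta> i l * (intensity \<beta> i j * intensity \<beta> j k
      + intensity \<beta> i j * intensity \<beta> k l + intensity \<beta> j k * intensity \<beta> k l)
    \<le> intensity \<beta> i j * intensity \<beta> j k * intensity \<beta> k l"
proof (rule optimal_exchange[OF path_edges_subset_card[OF lab] _ _ _ opt])
  note d = labelling_distinct[OF lab] labelling_distinct[OF lab, symmetric]
  let ?l = "intensity \<beta>"
  show "ordered_pair i l \<in> pairs"
    using labelling_ordered_pair[OF lab] by auto
  show "0 < ?l i j * ?l j k * ?l k l"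
    by (simp add: intensity_pos)
  show "det (info_matrix (exchange_design (path_edges i j k l) (ordered_pair i l) e) \<beta>) =
      ((1 - e) / 3)\<^sup>2 * ((1 - e) / 3 * (?l i j * ?l j k * ?l k l)
      + e * (?l i l * (?l i j * ?l j k + ?l i j * ?l k l + ?l j k * ?l k l)))" for e
  proof -
    define t where "t = (1 - e) / 3"
    define A where "A = edge_weight (exchange_design (path_edges i j k l) (ordered_pair i l) e) \<beta>"
    have A: "A i j = t * ?l i j" "A j k = t * ?l j k" "A k l = t * ?l k l" "A i l = e * ?l i l"
      "A i k = 0" "A j l = 0"
      by (simp_all add: d A_def t_def edge_weight_def exchange_design_def design_on_def
          path_edges_def ordered_pair_eq_iff)
    have "spanning_tree_sum A i j k l = t\<^sup>2 * (t * (?l i j * ?l j k * ?l k l)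
        + e * (?l i l * (?l i j * ?l j k + ?l i j * ?l k l + ?l j k * ?l k l)))"
      unfolding spanning_tree_sum_def A by (simp add: power2_eq_square algebra_simps)
    then show ?thesis
      unfolding det_info_matrix[OF lab] A_def t_def .
  qed
qed

lemma det_path:
  assumes lab: "{i, j, k, l} = {1..4::nat}"
  shows "det (info_matrix (design_on (path_edges i j k l)) \<beta>)
    = intensity \<beta> i j * intensity \<beta> j k * intensity \<beta> k l / 27"
proof -
  note d = labelling_distinct[OF lab] labelling_distinct[OF lab, symmetric]
  define A where "A = edge_weight (design_on (path_edges i j k l)) \<beta>"
  have A: "A i j = intensity \<beta> i j / 3" "A j k = intensity \<beta> j k / 3"
    "A k l = intensity \<beta> k l / 3" "A i l = 0" "A i k = 0" "A j l = 0"
    by (simp_all add: d A_def edge_weight_def design_on_def path_edges_def ordered_pair_eq_iff)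
  show ?thesis
    unfolding det_info_matrix[OF lab] A_def[symmetric] spanning_tree_sum_def A by simp
qed

section \<open>Regions of optimality of paths\<close>

text \<open>
  The entries \<open>p\<close>, \<open>s\<close>, \<open>u\<close> of the diagonal, divided by the intensities of their path edges, add up to
  the sum of all weights, where the weight of an edge outside the path carries the factor that
  the corresponding inequality bounds by 1. So the scaled trace is at most 1, and the scaled
  determinant at most \<open>1 / 27\<close>.
\<close>

lemma path_inequalities_imp_det_le:
  assumes lab: "{i, j, k, l} = {1..4::nat}"
    and ik: "intensity \<beta> i k * (intensity \<beta> i j + intensity \<beta> j k)
      \<le> intensity \<beta> i j * intensity \<beta> j k"
    and jl: "intensity \<beta> j l * (intensity \<beta> j k + intensity \<beta> k l)
      \<le> intensity \<beta> j k * intensity \<beta> k l"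
    and il: "intensity \<beta> i l * (intensity \<beta> i j * intensity \<beta> j k
        + intensity \<beta> i j * intensity \<beta> k l + intensity \<beta> j k * intensity \<beta> k l)
      \<le> intensity \<beta> i j * intensity \<beta> j k * intensity \<beta> k l"
    and v: "is_design v"
  shows "det (info_matrix v \<beta>) \<le> intensity \<beta> i j * intensity \<beta> j k * intensity \<beta> k l / 27"
proof -
  let ?l = "intensity \<beta>"
  define a b c x y z where abbr: "a = ?l i j" "b = ?l j k" "c = ?l k l" "x = ?l i k" "y = ?l j l" "z = ?l i l"
  define A where "A = edge_weight v \<beta>"
  have pos: "0 < a" "0 < b" "0 < c"
    by (simp_all add: abbr intensity_pos)
  have v_nonneg: "0 \<le> v p" for p
    using v unfolding is_design_def by (metis order_refl)
  then have A_nonneg: "0 \<le> A m n" for m n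
    using intensity_pos[of \<beta> m n] by (simp add: A_def edge_weight_def)
  let ?v = "\<lambda>m n. v (ordered_pair m n)"
  let ?p = "A i j + A i k + A i l"
  let ?s = "A j k + A i k + A j l + A i l"
  let ?u = "A k l + A j l + A i l"
  have nonneg: "0 \<le> ?p / a" "0 \<le> ?s / b" "0 \<le> ?u / c"
    using pos A_nonneg by (auto intro!: divide_nonneg_pos add_nonneg_nonneg)
  have "x * (1 / a + 1 / b) \<le> 1" "y * (1 / b + 1 / c) \<le> 1" "z * (1 / a + 1 / b + 1 / c) \<le> 1"
    using ik jl il pos unfolding abbr[symmetric] by (simp_all add: field_simps)
  then have "?v i k * (x * (1 / a + 1 / b)) \<le> ?v i k" "?v j l * (y * (1 / b + 1 / c)) \<le> ?v j l"
    "?v i l * (z * (1 / a + 1 / b + 1 / c)) \<le> ?v i l"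
    using v_nonneg by (simp_all add: mult_left_le)
  moreover have "?p / a + ?s / b + ?u / c = ?v i j + ?v j k + ?v k l + ?v i k * (x * (1 / a + 1 / b))
      + ?v j l * (y * (1 / b + 1 / c)) + ?v i l * (z * (1 / a + 1 / b + 1 / c))"
    using pos unfolding A_def edge_weight_def abbr[symmetric] by (simp add: field_simps)
  moreover have "?v i j + ?v j k + ?v k l + ?v i k + ?v j l + ?v i l = 1"
    using v unfolding is_design_def sum_pairs_labelling[OF lab] by blast
  ultimately have trace: "?p / a + ?s / b + ?u / c \<le> 1"
    by linarith
  have "27 * (?p / a * (?s / b) * (?u / c)) \<le> (?p / a + ?s / b + ?u / c) ^ 3"
    by (rule geometric_mean_3[OF nonneg])
  also have "\<dots> \<le> 1"
    using trace nonneg by (intro power_le_one add_nonneg_nonneg)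
  finally have "27 * (?p * ?s * ?u) \<le> a * b * c"
    using pos by (simp add: field_simps)
  moreover have "det (info_matrix v \<beta>) \<le> ?p * ?s * ?u"
    unfolding det_info_matrix[OF lab] A_def[symmetric]
    by (rule spanning_tree_sum_le_cuts[OF A_nonneg])
  ultimately show ?thesis
    unfolding abbr[symmetric] by linarith
qed

lemma optimality_region_path:
  assumes lab: "{i, j, k, l} = {1..4::nat}"
  shows "optimality_region (design_on (path_edges i j k l)) =
    {\<beta>. let l' = intensity \<beta> in
      l' i k * (l' i j + l' j k) - l' i j * l' j k \<le> 0
      \<and> l' j l * (l' j k + l' k l) - l' j k * l' k l \<le> 0
      \<and> l' i l * (l' i j * l' j k + l' i j * l' k l + l' j k * l' k l) - l' i j * l' j k * l' k l \<le> 0}"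
    (is "_ = {\<beta>. ?ineq \<beta>}")
proof -
  have "locally_D_optimal (design_on (path_edges i j k l)) \<beta> \<longleftrightarrow> ?ineq \<beta>" for \<beta>
  proof
    assume opt: "locally_D_optimal (design_on (path_edges i j k l)) \<beta>"
    have "intensity \<beta> i k * (intensity \<beta> i j + intensity \<beta> j k) \<le> intensity \<beta> i j * intensity \<beta> j k"
      using opt optimal_triangle_inequality[OF lab, of k \<beta>] by (simp add: path_edges_def)
    moreover have "{j, k, l, i} = {1..4}"
      using lab by auto
    then have "intensity \<beta> j l * (intensity \<beta> j k + intensity \<beta> k l) \<le> intensity \<beta> j k * intensity \<beta> k l"
      using opt optimal_triangle_inequality[of j k l i j \<beta>]
      by (simp add: path_edges_def insert_commute ordered_pair_commute[of j i])
    ultimately show "?ineq \<beta>"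
      using optimal_four_cycle_inequality[OF lab opt] by (simp add: Let_def)
  next
    assume ineq: "?ineq \<beta>"
    then have "det (info_matrix v \<beta>) \<le> det (info_matrix (design_on (path_edges i j k l)) \<beta>)"
      if "is_design v" for v
      unfolding det_path[OF lab] Let_def using that
      by (intro path_inequalities_imp_det_le[OF lab]) simp_all
    then show "locally_D_optimal (design_on (path_edges i j k l)) \<beta>"
      using design_on_is_design[OF path_edges_subset_card[OF lab]]
      by (simp add: locally_D_optimal_def log_ereal_mono)
  qed
  then show ?thesis
    by (simp add: optimality_region_def)
qed

text \<open>
  Only differences of parameters matter, so the parameter of alternative 4 can be shifted to 0.
\<close>

lemma ex_par_differences: "\<exists>\<beta>. \<forall>i\<in>{1..4}. \<forall>j\<in>{1..4}. par \<beta> i - par \<beta> j = u i - u j"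
proof -
  define \<beta> :: "real^3" where "\<beta> = vector [u 1 - u 4, u 2 - u 4, u 3 - u 4]"
  have "par \<beta> i = u i - u 4" if "i \<in> {1..4}" for i
  proof -
    have "i = 1 \<or> i = 2 \<or> i = 3 \<or> i = 4"
      using that by auto
    then show ?thesis
      by (elim disjE) (simp_all add: par_def \<beta>_def vector_3)
  qed
  then show ?thesis
    by (intro exI[of _ \<beta>]) simp
qed

text \<open>
  Parameters that decrease along the path in steps of \<open>ln 10\<close>. The intensities are then roughly
  \<open>1 / 10\<close>, \<open>1 / 100\<close> and \<open>1 / 1000\<close> at distances one, two and three.
\<close>

lemma optimality_region_path_nonempty:
  assumes lab: "{i, j, k, l} = {1..4::nat}"
  shows "optimality_region (design_on (path_edges i j k l)) \<noteq> {}"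
proof -
  define u where "u = (\<lambda>n. (if n = i then 3 else if n = j then 2 else if n = k then 1 else 0) * ln (10::real))"
  obtain \<beta> where \<beta>: "par \<beta> m - par \<beta> n = u m - u n" if "m \<in> {i, j, k, l}" "n \<in> {i, j, k, l}" for m n
    using ex_par_differences[of u] unfolding lab by blast
  note d = labelling_distinct[OF lab] labelling_distinct[OF lab, symmetric]
  have e: "exp (1 * ln 10) = (10::real)" "exp (2 * ln 10) = (100::real)" "exp (3 * ln 10) = (1000::real)"
    using exp_of_nat_mult[of 2 "ln (10::real)"] exp_of_nat_mult[of 3 "ln (10::real)"] by simp_all
  have diff: "par \<beta> i - par \<beta> j = 1 * ln 10" "par \<beta> j - par \<beta> k = 1 * ln 10" "par \<beta> k - par \<beta> l = 1 * ln 10"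
    "par \<beta> i - par \<beta> k = 2 * ln 10" "par \<beta> j - par \<beta> l = 2 * ln 10" "par \<beta> i - par \<beta> l = 3 * ln 10"
    using d by (simp_all add: \<beta> u_def)
  have l_vals: "intensity \<beta> i j = 10 / 121" "intensity \<beta> j k = 10 / 121" "intensity \<beta> k l = 10 / 121"
    "intensity \<beta> i k = 100 / 10201" "intensity \<beta> j l = 100 / 10201" "intensity \<beta> i l = 1000 / 1002001"
    unfolding intensity_def diff e by simp_all
  have "\<beta> \<in> optimality_region (design_on (path_edges i j k l))"
    unfolding optimality_region_path[OF lab] mem_Collect_eq Let_def l_vals by simp
  then show ?thesis
    by blast
qed

section \<open>Stars and triangles\<close>

definition star_edges :: "nat \<Rightarrow> (nat \<times> nat) set" where
  "star_edges c = {p \<in> pairs. fst p = c \<or> snd p = c}"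

lemma star_edges_labelling:
  assumes lab: "{c, i, j, k} = {1..4::nat}"
  shows "star_edges c = {ordered_pair c i, ordered_pair c j, ordered_pair c k}"
proof -
  have "ordered_pair m n \<in> star_edges c \<longleftrightarrow> ordered_pair m n \<in> pairs \<and> (m = c \<or> n = c)" for m n
    by (auto simp: star_edges_def ordered_pair_def min_def max_def)
  moreover have "star_edges c \<subseteq> pairs"
    by (auto simp: star_edges_def)
  ultimately show ?thesis
    using labelling_distinct[OF lab] unfolding pairs_labelling[OF lab] by auto
qed

text \<open>
  Otherwise the intensity of the pair \<open>i, k\<close> would be at least the smaller of the other two, and its
  product with their sum would exceed their product.
\<close>

lemma triangle_inequality_imp_far:
  assumes "intensity \<beta> i k * (intensity \<beta> i j + intensity \<beta> j k) \<le> intensity \<beta> i j * intensity \<beta> j k"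
  shows "\<bar>par \<beta> i - par \<beta> j\<bar> < \<bar>par \<beta> i - par \<beta> k\<bar>" "\<bar>par \<beta> j - par \<beta> k\<bar> < \<bar>par \<beta> i - par \<beta> k\<bar>"
proof -
  note pos = intensity_pos[of \<beta> i j] intensity_pos[of \<beta> j k]
  have *: "\<not> intensity \<beta> i j \<le> intensity \<beta> i k" "\<not> intensity \<beta> j k \<le> intensity \<beta> i k"
  proof (safe)
    assume "intensity \<beta> i j \<le> intensity \<beta> i k"
    then have "intensity \<beta> i j * (intensity \<beta> i j + intensity \<beta> j k) \<le> intensity \<beta> i j * intensity \<beta> j k"
      using assms pos by (smt (verit) mult_right_mono)
    then show False
      using pos by simp
  next
    assume "intensity \<beta> j k \<le> intensity \<beta> i k"
    then have "intensity \<beta> j k * (intensity \<beta> i j + intensity \<beta> j k) \<le> intensity \<beta> i j * intensity \<beta> j k"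
      using assms pos by (smt (verit) mult_right_mono)
    then show False
      using pos by (simp add: distrib_left mult.commute mult_le_0_iff)
  qed
  then show "\<bar>par \<beta> i - par \<beta> j\<bar> < \<bar>par \<beta> i - par \<beta> k\<bar>" "\<bar>par \<beta> j - par \<beta> k\<bar> < \<bar>par \<beta> i - par \<beta> k\<bar>"
    using intensity_mono[of \<beta> i k i j] intensity_mono[of \<beta> i k j k] by force+
qed

text \<open>
  Among the three leaves two lie on the same side of the centre, and they cannot be farther apart
  than both are from the centre.
\<close>

lemma optimality_region_star_empty:
  assumes lab: "{c, i, j, k} = {1..4::nat}"
  shows "optimality_region (design_on (star_edges c)) = {}"
proof -
  have far: "\<bar>par \<beta> x - par \<beta> c\<bar> < \<bar>par \<beta> x - par \<beta> y\<bar>" "\<bar>par \<beta> c - par \<beta> y\<bar> < \<bar>par \<beta> x - par \<beta> y\<bar>"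
    if opt: "locally_D_optimal (design_on (star_edges c)) \<beta>"
      and xyz: "{x, c, y, z} = {1..4}" for \<beta> x y z
  proof -
    have "{c, x, y, z} = {1..4}"
      using xyz by auto
    then have "star_edges c = {ordered_pair x c, ordered_pair c y, ordered_pair c z}"
      using star_edges_labelling ordered_pair_commute by metis
    then show "\<bar>par \<beta> x - par \<beta> c\<bar> < \<bar>par \<beta> x - par \<beta> y\<bar>" "\<bar>par \<beta> c - par \<beta> y\<bar> < \<bar>par \<beta> x - par \<beta> y\<bar>"
      using optimal_triangle_inequality[OF xyz, of c \<beta>] opt triangle_inequality_imp_far[of \<beta> x y c]
      by simp_all
  qed
  have "\<not> locally_D_optimal (design_on (star_edges c)) \<beta>" for \<beta>
  proof
    assume opt: "locally_D_optimal (design_on (star_edges c)) \<beta>"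
    \<comment> \<open>one labelling for each pair of leaves\<close>
    have "{i, c, j, k} = {1..4}" "{i, c, k, j} = {1..4}" "{j, c, k, i} = {1..4}"
      using lab by auto
    from far[OF opt this(1)] far[OF opt this(2)] far[OF opt this(3)] show False
      by linarith
  qed
  then show ?thesis
    by (simp add: optimality_region_def)
qed

lemma optimality_region_triangle_empty:
  assumes lab: "{c, i, j, k} = {1..4::nat}"
  shows "optimality_region (design_on (pairs - star_edges c)) = {}"
proof -
  have "det (info_matrix (design_on (pairs - star_edges c)) \<beta>) = 0" for \<beta>
    unfolding det_info_matrix[OF lab] star_edges_labelling[OF lab]
    by (simp add: spanning_tree_sum_def edge_weight_def design_on_def)
  moreover have "0 < det (info_matrix (design_on (path_edges c i j k)) \<beta>)" for \<beta>
    by (simp add: det_path[OF lab] intensity_pos)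
  ultimately have "\<not> locally_D_optimal (design_on (pairs - star_edges c)) \<beta>" for \<beta>
    using design_on_is_design[OF path_edges_subset_card[OF lab]]
    by (auto simp: locally_D_optimal_def log_ereal_def not_le
        intro!: exI[of _ "design_on (path_edges c i j k)"])
  then show ?thesis
    by (simp add: optimality_region_def)
qed

section \<open>Paths as graphs\<close>

text \<open>
  The path is grown edge by edge: an edge at the vertex 1, then an edge that leaves the two
  vertices reached, and finally an edge at the remaining vertex, which by the bound on the degrees
  ends in an end of the path. Any further edge would close a triangle or a 4-cycle. The conditions
  suit both connected graphs without cycles and sets of three pairs.
\<close>

lemma path_of_relation:
  fixes R :: "nat \<Rightarrow> nat \<Rightarrow> bool"
  assumes sym: "\<And>a b. R a b \<Longrightarrow> R b a"
    and neighbour: "\<And>a b c d. {a, b, c, d} = {1..4} \<Longrightarrow> R a b \<or> R a c \<or> R a d"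
    and cut: "\<And>a b c d. {a, b, c, d} = {1..4} \<Longrightarrow> R a c \<or> R a d \<or> R b c \<or> R b d"
    and degree: "\<And>a b c d. {a, b, c, d} = {1..4} \<Longrightarrow> \<not> (R a b \<and> R a c \<and> R a d)"
    and triangle: "\<And>a b c d. {a, b, c, d} = {1..4} \<Longrightarrow> \<not> (R a b \<and> R b c \<and> R c a)"
    and four_cycle: "\<And>a b c d. {a, b, c, d} = {1..4} \<Longrightarrow> \<not> (R a b \<and> R b c \<and> R c d \<and> R d a)"
  obtains i j k l where "{i, j, k, l} = {1..4}" "R i j" "R j k" "R k l"
    "\<not> R i k" "\<not> R j l" "\<not> R i l"
proof -
  obtain a b c d where ab: "{a, b, c, d} = {1..4}" "R a b"
  proof -
    have V: "{1, 2, 3, 4} = {1..4::nat}"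
      by auto
    then have "{1, 3, 2, 4} = {1..4::nat}" "{1, 4, 3, 2} = {1..4::nat}"
      by (simp_all add: insert_commute)
    with V neighbour[OF V] show thesis
      using that by blast
  qed
  obtain x y z t where xyz: "{x, y, z, t} = {1..4}" "R x y" "R y z"
  proof -
    have *: "{a, b, d, c} = {1..4}" "{b, a, c, d} = {1..4}" "{b, a, d, c} = {1..4}"
      using ab(1) by (simp_all add: insert_commute)
    from cut[OF ab(1)] show thesis
      using that[OF ab] that[OF *(1) ab(2)] that[OF *(2) sym[OF ab(2)]] that[OF *(3) sym[OF ab(2)]]
      by blast
  qed
  obtain i j k l where lab: "{i, j, k, l} = {1..4}" and R: "R i j" "R j k" "R k l"
  proof -
    have perm: "{t, x, y, z} = {1..4}" "{y, x, z, t} = {1..4}"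
      using xyz(1) by (simp_all add: insert_commute)
    then have "R t x \<or> R t z"
      using neighbour[OF perm(1)] degree[OF perm(2)] sym[of x y] xyz(3) sym[of t y] xyz(2) by blast
    then show thesis
      using that[OF perm(1) _ xyz(2,3)] that[OF xyz sym] by blast
  qed
  have "{j, k, l, i} = {1..4}"
    using lab by (simp add: insert_commute)
  then have "\<not> R i k" "\<not> R j l" "\<not> R i l"
    using triangle[OF lab] triangle[of j k l i] four_cycle[OF lab] R sym by blast+
  then show thesis
    using that lab R by blast
qed

lemma converse_pairs_disjoint: "S \<subseteq> pairs \<Longrightarrow> T \<subseteq> pairs \<Longrightarrow> S\<inverse> \<inter> T = {}"
  by (fastforce simp: pairs_def)

lemma support_design_on: "S \<subseteq> pairs \<Longrightarrow> support (design_on S) = S"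
  by (auto simp: support_def design_on_def)

lemma cycle_arcs:
  assumes "pre_digraph.cycle (with_proj G) c"
  shows "set c \<subseteq> parcs G" "distinct (map snd c)" "\<exists>u. pcas u c u"
proof -
  obtain u where u: "pre_digraph.awalk (with_proj G) u c u"
      "distinct (tl (pre_digraph.awalk_verts (with_proj G) u c))" "c \<noteq> []"
    using assms unfolding pre_digraph.cycle_def by blast
  then have cas: "pre_digraph.cas (with_proj G) u c u" and "set c \<subseteq> parcs G"
    unfolding pre_digraph.awalk_def by simp_all
  then show "set c \<subseteq> parcs G" "\<exists>u. pcas u c u"
    by (auto simp: cas_with_proj_eq)
  show "distinct (map snd c)"
    using u pre_digraph.awalk_verts_conv'[OF cas] by simp
qed

lemma cycleI:
  assumes "pcas u c u" "set c \<subseteq> parcs G" "u \<in> pverts G" "distinct (map snd c)" "c \<noteq> []"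
  shows "pre_digraph.cycle (with_proj G) c"
proof -
  have "pre_digraph.cas (with_proj G) u c u"
    using assms by (simp add: cas_with_proj_eq)
  then show ?thesis
    using assms unfolding pre_digraph.cycle_def pre_digraph.awalk_def
    by (intro exI[of _ u]) (simp add: pre_digraph.awalk_verts_conv')
qed

text \<open>
  Otherwise no vertex outside \<open>X\<close> would be reachable from \<open>x\<close>.
\<close>

lemma connected_crossing_arc:
  assumes "pair_graph G" and con: "Digraph_Component.connected (with_proj G)"
    and "x \<in> pverts G" "y \<in> pverts G" "x \<in> X" "y \<notin> X"
  shows "\<exists>a\<in>X. \<exists>b. b \<notin> X \<and> (a, b) \<in> parcs G"
proof (rule ccontr)
  interpret pair_graph G by fact
  assume no: "\<not> ?thesis"
  let ?H = "with_proj (mk_symmetric (with_proj G))"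
  have arcs: "(a, b) \<in> parcs G" if "(a, b) \<in> arcs_ends ?H" for a b
    using that graph_symmetric by (auto simp: mk_symmetric_def)
  have "x \<rightarrow>\<^sup>*\<^bsub>?H\<^esub> y"
    using con assms(3,4) by (auto simp: connected_def strongly_connected_def mk_symmetric_def)
  then have "y \<in> X"
    unfolding reachable_def
    by (induction rule: rtrancl_on_induct) (use no arcs \<open>x \<in> X\<close> in blast)+
  then show False
    using \<open>y \<notin> X\<close> by simp
qed

lemma path_arcs:
  "path_edges i j k l \<union> (path_edges i j k l)\<inverse> = {(i,j), (j,i), (j,k), (k,j), (k,l), (l,k)}"
  by (auto simp: path_edges_def ordered_pair_def min_def max_def)

lemma graph_rep_path:
  assumes "{i, j, k, l} = {1..4}"
  shows "graph_rep (design_on (path_edges i j k l)) =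
    \<lparr>pverts = {i, j, k, l}, parcs = {(i,j), (j,i), (j,k), (k,j), (k,l), (l,k)}\<rparr>"
  using path_edges_subset_card[OF assms] assms
  by (simp add: graph_rep_def support_design_on path_arcs)

text \<open>
  A cycle has at most four vertices. Along each arc the position on the path changes by one: for a
  cycle of length three this contradicts parity, and for a cycle of length four two opposite
  vertices would have the same position.
\<close>

lemma path_acyclic:
  assumes lab: "{i, j, k, l} = {1..4::nat}"
    and G: "G = \<lparr>pverts = {i, j, k, l}, parcs = {(i,j), (j,i), (j,k), (k,j), (k,l), (l,k)}\<rparr>"
    and cycle: "pre_digraph.cycle (with_proj G) c"
  shows "length c < 3"
proof (rule ccontr)
  assume "\<not> length c < 3"
  note d = labelling_distinct[OF lab] labelling_distinct[OF lab, symmetric]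
  define pos :: "nat \<Rightarrow> int" where
    "pos = (\<lambda>v. if v = i then 0 else if v = j then 1 else if v = k then 2 else 3)"
  have arc: "pos a = pos b + 1 \<or> pos b = pos a + 1" if "(a, b) \<in> parcs G" for a b
    using that by (auto simp: d G pos_def)
  obtain u where arcs: "set c \<subseteq> parcs G" and dist: "distinct (map snd c)" and cas: "pcas u c u"
    using cycle_arcs[OF cycle] by blast
  have inj: "inj_on pos {i, j, k, l}"
    by (simp add: d pos_def)
  have heads: "snd ` set c \<subseteq> {i, j, k, l}"
    using arcs by (auto simp: G)
  then have "card (set (map snd c)) \<le> card {i, j, k, l}"
    by (intro card_mono) auto
  then have "length c \<le> 4"
    using distinct_card[OF dist] lab by simp
  with \<open>\<not> length c < 3\<close> consider "length c = 3" | "length c = 4"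
    by linarith
  then show False
  proof cases
    case 1
    then obtain x y z where "c = [(u, x), (x, y), (y, u)]"
      using cas by (auto simp: length_Suc_conv numeral_eq_Suc)
    then have "(u, x) \<in> parcs G" "(x, y) \<in> parcs G" "(y, u) \<in> parcs G"
      using arcs by auto
    then show False
      using arc[of u x] arc[of x y] arc[of y u] by presburger
  next
    case 2
    then obtain x y z where c: "c = [(u, x), (x, y), (y, z), (z, u)]"
      using cas by (auto simp: length_Suc_conv numeral_eq_Suc)
    then have "(u, x) \<in> parcs G" "(x, y) \<in> parcs G" "(y, z) \<in> parcs G" "(z, u) \<in> parcs G"
      using arcs by auto
    moreover have "pos u \<noteq> pos y" "pos x \<noteq> pos z"
      using dist inj heads c by (auto simp: inj_on_def)
    ultimately show False
      using arc[of u x] arc[of x y] arc[of y z] arc[of z u] by linarith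
  qed
qed

lemma connected_pair_graphI:
  assumes "pair_graph G" "pverts G \<noteq> {}"
    and reach: "\<And>u v. u \<in> pverts G \<Longrightarrow> v \<in> pverts G \<Longrightarrow> (u, v) \<in> (parcs G)\<^sup>*"
  shows "Digraph_Component.connected (with_proj G)"
proof -
  interpret pair_graph G by fact
  have "parcs (mk_symmetric (with_proj G)) = parcs G"
    using graph_symmetric by (auto simp: mk_symmetric_def)
  moreover have "pverts (mk_symmetric (with_proj G)) = pverts G"
    by (simp add: mk_symmetric_def)
  moreover have "(u, v) \<in> rtrancl_on (pverts G) (parcs G)"
    if "u \<in> pverts G" "v \<in> pverts G" for u v
    using reach[OF that] that in_arcsD2 by (rule rtrancl_consistent_rtrancl_on)
  ultimately show ?thesis
    using assms by (simp add: connected_def strongly_connected_def reachable_def)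
qed

lemma graph_rep_path_in_labeled_paths:
  assumes lab: "{i, j, k, l} = {1..4}"
  shows "graph_rep (design_on (path_edges i j k l)) \<in> labeled_paths"
proof -
  define G where "G = graph_rep (design_on (path_edges i j k l))"
  note d = labelling_distinct[OF lab] labelling_distinct[OF lab, symmetric]
  note G = graph_rep_path[OF lab, folded G_def]
  have pg: "pair_graph G"
    by unfold_locales (auto simp: d G symmetric_def sym_def)
  have steps: "(i, j) \<in> parcs G" "(j, k) \<in> parcs G" "(k, l) \<in> parcs G"
    "(j, i) \<in> parcs G" "(k, j) \<in> parcs G" "(l, k) \<in> parcs G"
    by (simp_all add: G)
  have "(i, j) \<in> (parcs G)\<^sup>*" "(i, k) \<in> (parcs G)\<^sup>*" "(i, l) \<in> (parcs G)\<^sup>*"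
    "(j, i) \<in> (parcs G)\<^sup>*" "(k, i) \<in> (parcs G)\<^sup>*" "(l, i) \<in> (parcs G)\<^sup>*"
    using steps by (meson r_into_rtrancl rtrancl_trans)+
  then have "(u, i) \<in> (parcs G)\<^sup>*" "(i, u) \<in> (parcs G)\<^sup>*" if "u \<in> pverts G" for u
    using that by (auto simp: G)
  then have "(u, v) \<in> (parcs G)\<^sup>*" if "u \<in> pverts G" "v \<in> pverts G" for u v
    using that by (meson rtrancl_trans)
  then have "Digraph_Component.connected (with_proj G)"
    by (intro connected_pair_graphI[OF pg]) (auto simp: G)
  moreover have "out_degree (with_proj G) v \<le> 2" for v
  proof -
    have "out_arcs (with_proj G) v \<subseteq> {(v, if v = i \<or> v = k then j else k), (v, if v = j then i else l)}"
      by (auto simp: d out_arcs_def G)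
    from card_mono[OF _ this] show ?thesis
      unfolding out_degree_def by (rule order_trans) (simp_all add: card_insert_le_m1)
  qed
  ultimately show ?thesis
    using pg path_acyclic[OF lab G] lab unfolding G_def[symmetric] labeled_paths_def is_path_def is_tree_def
    by (auto simp: G not_le)
qed

lemma labeled_paths_imp_path:
  assumes "G \<in> labeled_paths"
  obtains i j k l where "{i, j, k, l} = {1..4}" "G = graph_rep (design_on (path_edges i j k l))"
proof -
  have pg: "pair_graph G" and verts: "pverts G = {1..4}"
    and con: "Digraph_Component.connected (with_proj G)"
    and acyclic: "\<And>c. pre_digraph.cycle (with_proj G) c \<Longrightarrow> length c < 3"
    and deg: "\<And>v. v \<in> {1..4} \<Longrightarrow> out_degree (with_proj G) v \<le> 2"
    using assms by (auto simp: labeled_paths_def is_path_def is_tree_def not_le)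
  interpret pair_graph G by fact
  have sym: "(b, a) \<in> parcs G" if "(a, b) \<in> parcs G" for a b
    using that graph_symmetric by auto
  have cross: "\<exists>a\<in>X. \<exists>b\<in>{1..4} - X. (a, b) \<in> parcs G" if "x \<in> X" "y \<notin> X" "x \<in> {1..4}" "y \<in> {1..4}" for x y X
    using connected_crossing_arc[OF pg con, of x y X] that in_arcsD2 unfolding verts by blast
  obtain i j k l where lab: "{i, j, k, l} = {1..4}" and R: "(i, j) \<in> parcs G" "(j, k) \<in> parcs G" "(k, l) \<in> parcs G"
    and nR: "(i, k) \<notin> parcs G" "(j, l) \<notin> parcs G" "(i, l) \<notin> parcs G"
  proof (rule path_of_relation[of "\<lambda>a b. (a, b) \<in> parcs G"])
    fix a b c d :: nat
    assume lab: "{a, b, c, d} = {1..4}"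
    note ne = labelling_distinct[OF lab] labelling_distinct[OF lab, symmetric]
    have V: "a \<in> {1..4}" "b \<in> {1..4}" "c \<in> {1..4}" "d \<in> {1..4}"
      using lab by auto
    show "(a, b) \<in> parcs G \<or> (a, c) \<in> parcs G \<or> (a, d) \<in> parcs G"
      using cross[of a "{a}" b] V unfolding lab[symmetric] by (auto simp: ne)
    show "(a, c) \<in> parcs G \<or> (a, d) \<in> parcs G \<or> (b, c) \<in> parcs G \<or> (b, d) \<in> parcs G"
      using cross[of a "{a, b}" c] V unfolding lab[symmetric] by (auto simp: ne)
    show "\<not> ((a, b) \<in> parcs G \<and> (a, c) \<in> parcs G \<and> (a, d) \<in> parcs G)"
    proof
      assume "(a, b) \<in> parcs G \<and> (a, c) \<in> parcs G \<and> (a, d) \<in> parcs G"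
      then have "card {(a, b), (a, c), (a, d)} \<le> out_degree (with_proj G) a"
        unfolding out_degree_def using pair_finite_arcs by (intro card_mono) (auto simp: out_arcs_def)
      then show False
        using deg[OF V(1)] ne by simp
    qed
    show "\<not> ((a, b) \<in> parcs G \<and> (b, c) \<in> parcs G \<and> (c, a) \<in> parcs G)"
      using acyclic[OF cycleI[of a "[(a, b), (b, c), (c, a)]" G]] V by (auto simp: ne verts)
    show "\<not> ((a, b) \<in> parcs G \<and> (b, c) \<in> parcs G \<and> (c, d) \<in> parcs G \<and> (d, a) \<in> parcs G)"
      using acyclic[OF cycleI[of a "[(a, b), (b, c), (c, d), (d, a)]" G]] V by (auto simp: ne verts)
  qed (use sym in blast)+
  have "parcs G = {(i,j), (j,i), (j,k), (k,j), (k,l), (l,k)}"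
  proof (rule set_eqI, clarify)
    fix a b
    have "a \<noteq> b \<and> a \<in> {i, j, k, l} \<and> b \<in> {i, j, k, l}" if "(a, b) \<in> parcs G"
      using that pair_no_loops[OF that] in_arcsD1[OF that] in_arcsD2[OF that] unfolding verts lab by simp
    then show "(a, b) \<in> parcs G \<longleftrightarrow> (a, b) \<in> {(i,j), (j,i), (j,k), (k,j), (k,l), (l,k)}"
      using R nR sym by auto
  qed
  then have "G = graph_rep (design_on (path_edges i j k l))"
    unfolding graph_rep_path[OF lab] using verts lab by simp
  then show thesis
    using that lab by blast
qed

section \<open>Classification of the saturated designs\<close>

lemma saturated_designs_eq: "saturated_designs = design_on ` {S. S \<subseteq> pairs \<and> card S = 3}"
proof (intro equalityI subsetI)
  fix w
  assume "w \<in> saturated_designs"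
  then have w: "is_design w" "card (support w) = 3" "\<forall>p\<in>support w. w p = 1/3"
    by (auto simp: saturated_designs_def)
  have "w p = design_on (support w) p" for p
  proof (cases "p \<in> support w")
    case True
    then show ?thesis
      using w(3) by (simp add: design_on_def)
  next
    case False
    then have "w p = 0"
      using w(1) unfolding is_design_def support_def by (smt (verit) mem_Collect_eq)
    then show ?thesis
      using False by (simp add: design_on_def)
  qed
  then have "w = design_on (support w)"
    by (rule ext)
  moreover have "support w \<subseteq> pairs"
    by (auto simp: support_def)
  ultimately show "w \<in> design_on ` {S. S \<subseteq> pairs \<and> card S = 3}"
    using w(2) by (intro image_eqI[of _ _ "support w"]) auto
next
  fix w
  assume "w \<in> design_on ` {S. S \<subseteq> pairs \<and> card S = 3}"
  then obtain S where S: "S \<subseteq> pairs" "card S = 3" "w = design_on S"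
    by auto
  then show "w \<in> saturated_designs"
    using design_on_is_design by (simp add: saturated_designs_def support_design_on)
      (simp add: design_on_def)
qed

lemma inj_on_design_on: "inj_on design_on {S. S \<subseteq> pairs}"
  by (rule inj_on_inverseI[of _ support]) (simp add: support_design_on)

lemma inj_on_graph_rep: "inj_on graph_rep saturated_designs"
proof (rule inj_onI)
  fix v w
  assume "v \<in> saturated_designs" "w \<in> saturated_designs" and eq: "graph_rep v = graph_rep w"
  then obtain S T where S: "S \<subseteq> pairs" "v = design_on S" and T: "T \<subseteq> pairs" "w = design_on T"
    by (auto simp: saturated_designs_eq)
  have "S \<union> S\<inverse> = T \<union> T\<inverse>"
    using eq S T by (simp add: graph_rep_def support_design_on)
  then have "S = T"
    using converse_pairs_disjoint[of S T] converse_pairs_disjoint[of T S] S(1) T(1) by blast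
  then show "v = w"
    using S T by simp
qed

lemma labelling_ex:
  assumes "c \<in> {1..4::nat}"
  obtains i j k where "{c, i, j, k} = {1..4}"
proof -
  have V: "{1, 2, 3, 4} = {1..4::nat}"
    by auto
  then have "{2, 1, 3, 4} = {1..4::nat}" "{3, 1, 2, 4} = {1..4::nat}" "{4, 1, 2, 3} = {1..4::nat}"
    by (simp_all add: insert_commute)
  moreover have "c = 1 \<or> c = 2 \<or> c = 3 \<or> c = 4"
    using assms by auto
  ultimately show thesis
    using V that by blast
qed

lemma star_edges_subset: "star_edges c \<subseteq> pairs"
  by (auto simp: star_edges_def)

lemma card_star_edges:
  assumes "c \<in> {1..4}"
  shows "card (star_edges c) = 3" "card (pairs - star_edges c) = 3"
proof -
  obtain i j k where lab: "{c, i, j, k} = {1..4}"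
    using labelling_ex[OF assms] .
  show "card (star_edges c) = 3"
    unfolding star_edges_labelling[OF lab] using labelling_distinct[OF lab]
    by (simp add: ordered_pair_eq_iff)
  then show "card (pairs - star_edges c) = 3"
    using card_Diff_subset[OF finite_subset[OF star_edges_subset finite_pairs] star_edges_subset]
    by (simp add: card_pairs)
qed

definition non_path_edge_sets :: "(nat \<times> nat) set set" where
  "non_path_edge_sets = star_edges ` {1..4} \<union> (\<lambda>c. pairs - star_edges c) ` {1..4}"

text \<open>
  For \<open>c \<noteq> c'\<close> the stars share the edge from \<open>c\<close> to \<open>c'\<close>, which separates the star of \<open>c\<close> from the
  triangle opposite to \<open>c'\<close>, and the star of \<open>c\<close> has an edge that avoids \<open>c'\<close>, which separates the
  two stars.
\<close>

lemma card_non_path_edge_sets: "card non_path_edge_sets = 8"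
proof -
  have other: "\<exists>p q. p \<in> star_edges c \<and> p \<in> star_edges c' \<and> q \<in> star_edges c \<and> q \<notin> star_edges c'"
    if cc': "c \<in> {1..4}" "c' \<in> {1..4}" "c \<noteq> c'" for c c'
  proof -
    obtain i j k where lab: "{c, i, j, k} = {1..4}"
      using labelling_ex[OF cc'(1)] .
    note d = labelling_distinct[OF lab] labelling_distinct[OF lab, symmetric]
    have star: "ordered_pair m n \<in> star_edges x \<longleftrightarrow> ordered_pair m n \<in> pairs \<and> (m = x \<or> n = x)" for m n x
      by (auto simp: star_edges_def ordered_pair_def min_def max_def)
    have "i \<noteq> c' \<or> j \<noteq> c'"
      using d by blast
    then obtain m where m: "m \<noteq> c'" "ordered_pair c m \<in> pairs"
      using labelling_ordered_pair[OF lab] by blast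
    then have "ordered_pair c c' \<in> star_edges c \<and> ordered_pair c c' \<in> star_edges c'
        \<and> ordered_pair c m \<in> star_edges c \<and> ordered_pair c m \<notin> star_edges c'"
      using cc' by (simp add: star ordered_pair_mem_pairs)
    then show ?thesis
      by blast
  qed
  have nonempty: "star_edges c \<noteq> {}" if "c \<in> {1..4}" for c
    using card_star_edges(1)[OF that] by auto
  have "inj_on star_edges {1..4}"
    by (intro inj_onI) (use other in blast)
  moreover from this have "inj_on (\<lambda>c. pairs - star_edges c) {1..4}"
    unfolding inj_on_def using star_edges_subset by (metis double_diff order_refl)
  moreover have "star_edges c \<noteq> pairs - star_edges c'" if cc': "c \<in> {1..4}" "c' \<in> {1..4}" for c c'
    using other[OF cc'] nonempty[OF cc'(1)] star_edges_subset[of c] by (cases "c = c'") blast+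
  then have "star_edges ` {1..4} \<inter> (\<lambda>c. pairs - star_edges c) ` {1..4} = {}"
    by blast
  ultimately show ?thesis
    unfolding non_path_edge_sets_def by (subst card_Un_disjoint) (simp_all add: card_image)
qed

text \<open>
  A vertex without a neighbour leaves only the three pairs of a triangle, and a vertex of degree
  three makes a star. A triangle would use up the three edges and isolate the fourth vertex,
  a cut into two pairs without a crossing edge admits only two edges, and a 4-cycle has four.
\<close>

lemma three_pairs_cases:
  assumes S: "S \<subseteq> pairs" "card S = 3" and "S \<notin> non_path_edge_sets"
  obtains i j k l where "{i, j, k, l} = {1..4}" "S = path_edges i j k l"
proof -
  have fin: "finite S"
    using S finite_pairs finite_subset by blast
  have not_star: "\<not> star_edges c \<subseteq> S" "star_edges c \<inter> S \<noteq> {}" if "c \<in> {1..4}" for c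
  proof -
    have "star_edges c \<noteq> S" "pairs - star_edges c \<noteq> S"
      using assms(3) that by (auto simp: non_path_edge_sets_def)
    then show "\<not> star_edges c \<subseteq> S"
      using card_subset_eq[OF fin, of "star_edges c"] card_star_edges(1)[OF that] S(2) by metis
    have "finite (pairs - star_edges c)"
      using finite_pairs by blast
    then have "\<not> S \<subseteq> pairs - star_edges c"
      using card_subset_eq[of _ S] card_star_edges(2)[OF that] S(2)
        \<open>pairs - star_edges c \<noteq> S\<close> by metis
    then show "star_edges c \<inter> S \<noteq> {}"
      using S(1) by blast
  qed
  obtain i j k l where lab: "{i, j, k, l} = {1..4}"
    and "ordered_pair i j \<in> S" "ordered_pair j k \<in> S" "ordered_pair k l \<in> S"
  proof (rule path_of_relation[of "\<lambda>a b. ordered_pair a b \<in> S"])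
    fix a b c d :: nat
    assume lab: "{a, b, c, d} = {1..4}"
    then have a: "a \<in> {1..4}" and lab': "{d, a, b, c} = {1..4}"
      by (blast, simp add: insert_commute)
    note ne = labelling_distinct[OF lab] labelling_distinct[OF lab, symmetric]
    show "ordered_pair a b \<in> S \<or> ordered_pair a c \<in> S \<or> ordered_pair a d \<in> S"
      using not_star(2)[OF a] unfolding star_edges_labelling[OF lab] by blast
    show "\<not> (ordered_pair a b \<in> S \<and> ordered_pair a c \<in> S \<and> ordered_pair a d \<in> S)"
      using not_star(1)[OF a] unfolding star_edges_labelling[OF lab] by blast
    show "ordered_pair a c \<in> S \<or> ordered_pair a d \<in> S \<or> ordered_pair b c \<in> S \<or> ordered_pair b d \<in> S"
    proof (rule ccontr)
      assume "\<not> ?thesis"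
      then have "S \<subseteq> {ordered_pair a b, ordered_pair c d}"
        using S(1) unfolding pairs_labelling[OF lab] by blast
      from card_mono[OF _ this] show False
        using S(2) by (simp add: ne ordered_pair_eq_iff)
    qed
    show "\<not> (ordered_pair a b \<in> S \<and> ordered_pair b c \<in> S \<and> ordered_pair c a \<in> S)"
    proof
      assume "ordered_pair a b \<in> S \<and> ordered_pair b c \<in> S \<and> ordered_pair c a \<in> S"
      then have "{ordered_pair a b, ordered_pair b c, ordered_pair c a} \<subseteq> S"
        by blast
      moreover have "card {ordered_pair a b, ordered_pair b c, ordered_pair c a} = 3"
        by (simp add: ne ordered_pair_eq_iff)
      ultimately have "{ordered_pair a b, ordered_pair b c, ordered_pair c a} = S"
        using card_subset_eq[OF fin] S(2) by metis
      moreover have "d \<in> {1..4}"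
        using lab by blast
      ultimately show False
        using not_star(2)[of d] unfolding star_edges_labelling[OF lab']
        by (force simp: ne ordered_pair_eq_iff)
    qed
    show "\<not> (ordered_pair a b \<in> S \<and> ordered_pair b c \<in> S \<and> ordered_pair c d \<in> S \<and> ordered_pair d a \<in> S)"
    proof
      assume "ordered_pair a b \<in> S \<and> ordered_pair b c \<in> S \<and> ordered_pair c d \<in> S \<and> ordered_pair d a \<in> S"
      then have "{ordered_pair a b, ordered_pair b c, ordered_pair c d, ordered_pair d a} \<subseteq> S"
        by blast
      from card_mono[OF fin this] show False
        using S(2) by (simp add: ne ordered_pair_eq_iff)
    qed
  next
    fix a b
    assume "ordered_pair a b \<in> S"
    then show "ordered_pair b a \<in> S"
      by (simp add: ordered_pair_commute)
  qed
  then have "path_edges i j k l \<subseteq> S"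
    by (simp add: path_edges_def)
  then have "S = path_edges i j k l"
    using card_subset_eq[OF fin] path_edges_subset_card(2)[OF lab] S(2) by metis
  then show thesis
    using that lab by blast
qed

definition path_designs :: "(nat \<times> nat \<Rightarrow> real) set" where
  "path_designs = {design_on (path_edges i j k l) | i j k l. {i, j, k, l} = {1..4}}"

lemma path_designsI:
  "{i, j, k, l} = {1..4} \<Longrightarrow> design_on (path_edges i j k l) \<in> path_designs"
  unfolding path_designs_def by blast

lemma path_designs_subset: "path_designs \<subseteq> saturated_designs"
  using path_edges_subset_card by (fastforce simp: path_designs_def saturated_designs_eq)

text \<open>
  Paths have a nonempty region, stars and triangles an empty one, and there are no other cases. So
  the disjointness of the two families of designs comes from the regions themselves.
\<close>

lemma saturated_designs_by_region:
  "{w \<in> saturated_designs. optimality_region w = {}} = design_on ` non_path_edge_sets"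
  "{w \<in> saturated_designs. optimality_region w \<noteq> {}} = path_designs"
proof -
  have non_path: "design_on S \<in> saturated_designs \<and> optimality_region (design_on S) = {}"
    if non_path_S: "S \<in> non_path_edge_sets" for S
  proof -
    obtain c where c: "c \<in> {1..4}" and S: "S = star_edges c \<or> S = pairs - star_edges c"
      using non_path_S unfolding non_path_edge_sets_def by blast
    obtain i j k where "{c, i, j, k} = {1..4}"
      using labelling_ex[OF c] .
    then have "optimality_region (design_on S) = {}"
      using S optimality_region_star_empty optimality_region_triangle_empty by metis
    moreover have "S \<subseteq> pairs" "card S = 3"
      using S star_edges_subset card_star_edges[OF c] by auto
    ultimately show ?thesis
      by (simp add: saturated_designs_eq)
  qed
  have path: "w \<in> saturated_designs \<and> optimality_region w \<noteq> {}" if "w \<in> path_designs" for w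
    using that path_designs_subset optimality_region_path_nonempty unfolding path_designs_def by blast
  have cover: "w \<in> path_designs \<or> w \<in> design_on ` non_path_edge_sets" if w: "w \<in> saturated_designs" for w
  proof -
    obtain S where S: "S \<subseteq> pairs" "card S = 3" "w = design_on S"
      using w unfolding saturated_designs_eq by blast
    show ?thesis
    proof (cases "S \<in> non_path_edge_sets")
      case False
      then obtain i j k l where "{i, j, k, l} = {1..4}" "S = path_edges i j k l"
        using three_pairs_cases S by metis
      then show ?thesis
        using S(3) path_designsI by blast
    qed (use S(3) in blast)
  qed
  show "{w \<in> saturated_designs. optimality_region w = {}} = design_on ` non_path_edge_sets"
    "{w \<in> saturated_designs. optimality_region w \<noteq> {}} = path_designs"
    using non_path path cover by blast+
qed

lemma graph_rep_path_designs: "graph_rep ` path_designs = labeled_paths"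
proof (intro equalityI subsetI)
  fix G
  assume "G \<in> graph_rep ` path_designs"
  then show "G \<in> labeled_paths"
    using graph_rep_path_in_labeled_paths by (auto simp: path_designs_def)
next
  fix G
  assume "G \<in> labeled_paths"
  then show "G \<in> graph_rep ` path_designs"
    by (rule labeled_paths_imp_path) (use path_designsI in blast)
qed

lemma path_design_eq: "path_design \<sigma> = design_on (path_edges (\<sigma> 1) (\<sigma> 2) (\<sigma> 3) (\<sigma> 4))"
  by (simp add: path_design_def path_edges_def)

lemma permutes_labelling:
  assumes "\<sigma> permutes {1..4::nat}"
  shows "{\<sigma> 1, \<sigma> 2, \<sigma> 3, \<sigma> 4} = {1..4}"
proof -
  have "{1..4} = {1, 2, 3, 4::nat}"
    by auto
  then show ?thesis
    using permutes_image[OF assms] by simp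
qed

lemma path_design_image: "path_design ` {\<sigma>. \<sigma> permutes {1..4}} = path_designs"
proof (intro equalityI subsetI)
  fix w
  assume "w \<in> path_design ` {\<sigma>. \<sigma> permutes {1..4}}"
  then show "w \<in> path_designs"
    using path_designsI[OF permutes_labelling] by (auto simp only: path_design_eq mem_Collect_eq)
next
  fix w
  assume "w \<in> path_designs"
  then obtain i j k l where lab: "{i, j, k, l} = {1..4}" and w: "w = design_on (path_edges i j k l)"
    by (auto simp: path_designs_def)
  define \<sigma> where "\<sigma> = (\<lambda>n::nat. if n = 1 then i else if n = 2 then j else if n = 3 then k else if n = 4 then l else n)"
  have V: "{1..4} = {1, 2, 3, 4::nat}"
    by auto
  have "\<sigma> ` {1..4} = {\<sigma> 1, \<sigma> 2, \<sigma> 3, \<sigma> 4}"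
    unfolding V by simp
  also have "\<dots> = {i, j, k, l}"
    by (simp add: \<sigma>_def)
  finally have "\<sigma> ` {1..4} = {1..4}"
    unfolding lab .
  moreover from this have "inj_on \<sigma> {1..4}"
    by (intro eq_card_imp_inj_on) simp_all
  ultimately have "\<sigma> permutes {1..4}"
    by (intro bij_imp_permutes) (auto simp: bij_betw_def \<sigma>_def)
  moreover have "w = path_design \<sigma>"
    by (simp add: w path_design_eq \<sigma>_def)
  ultimately show "w \<in> path_design ` {\<sigma>. \<sigma> permutes {1..4}}"
    by blast
qed

theorem theorem12:
  shows "card saturated_designs = 20
    \<and> bij_betw design_on {S. S \<subseteq> pairs \<and> card S = 3} saturated_designs
    \<and> card {w \<in> saturated_designs. optimality_region w = {}} = 8
    \<and> card {w \<in> saturated_designs. optimality_region w \<noteq> {}} = 12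
    \<and> card labeled_paths = 12
    \<and> bij_betw graph_rep {w \<in> saturated_designs. optimality_region w \<noteq> {}} labeled_paths
    \<and> {w \<in> saturated_designs. optimality_region w \<noteq> {}} =
        {w \<in> saturated_designs. graph_rep w \<in> labeled_paths}
    \<and> {w \<in> saturated_designs. optimality_region w \<noteq> {}} = path_design ` {\<sigma>. \<sigma> permutes {1..4}}
    \<and> optimality_region (design_on {(1,2), (2,3), (3,4)}) =
        {\<beta>. let l = intensity \<beta> in
          l 1 3 * (l 1 2 + l 2 3) - l 1 2 * l 2 3 \<le> 0
          \<and> l 2 4 * (l 2 3 + l 3 4) - l 2 3 * l 3 4 \<le> 0
          \<and> l 1 4 * (l 1 2 * l 2 3 + l 1 2 * l 3 4 + l 2 3 * l 3 4) - l 1 2 * l 2 3 * l 3 4 \<le> 0}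
    \<and> (\<forall>\<sigma>. \<sigma> permutes {1..4} \<longrightarrow> optimality_region (path_design \<sigma>) =
        {\<beta>. let l = (\<lambda>i j. intensity \<beta> (\<sigma> i) (\<sigma> j)) in
          l 1 3 * (l 1 2 + l 2 3) - l 1 2 * l 2 3 \<le> 0
          \<and> l 2 4 * (l 2 3 + l 3 4) - l 2 3 * l 3 4 \<le> 0
          \<and> l 1 4 * (l 1 2 * l 2 3 + l 1 2 * l 3 4 + l 2 3 * l 3 4) - l 1 2 * l 2 3 * l 3 4 \<le> 0})"
proof (intro conjI allI impI)
  let ?N = "{w \<in> saturated_designs. optimality_region w \<noteq> {}}"
  let ?E = "{w \<in> saturated_designs. optimality_region w = {}}"
  show bij: "bij_betw design_on {S. S \<subseteq> pairs \<and> card S = 3} saturated_designs"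
    unfolding bij_betw_def saturated_designs_eq
    using inj_on_subset[OF inj_on_design_on, of "{S. S \<subseteq> pairs \<and> card S = 3}"] by auto
  have "(6::nat) choose 3 = 20"
    by (simp add: numeral_eq_Suc)
  then show card: "card saturated_designs = 20"
    using n_subsets[OF finite_pairs, of 3] by (simp add: bij_betw_same_card[OF bij, symmetric] card_pairs)
  have "non_path_edge_sets \<subseteq> {S. S \<subseteq> pairs}"
    using star_edges_subset by (auto simp: non_path_edge_sets_def)
  then show card_E: "card ?E = 8"
    unfolding saturated_designs_by_region
    using card_image[OF inj_on_subset[OF inj_on_design_on]] card_non_path_edge_sets by metis
  have fin: "finite saturated_designs"
    using card by (intro card_ge_0_finite) simp
  have "saturated_designs = ?E \<union> ?N" "?E \<inter> ?N = {}"
    by auto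
  then have "card saturated_designs = card ?E + card ?N"
    using card_Un_disjoint[of ?E ?N] fin by simp
  then show card_N: "card ?N = 12"
    using card card_E by simp
  show bij_graph: "bij_betw graph_rep ?N labeled_paths"
    unfolding bij_betw_def saturated_designs_by_region
    using graph_rep_path_designs inj_on_subset[OF inj_on_graph_rep path_designs_subset] by simp
  show "card labeled_paths = 12"
    using bij_betw_same_card[OF bij_graph] card_N by (rule trans[OF sym])
  show "?N = {w \<in> saturated_designs. graph_rep w \<in> labeled_paths}"
    unfolding saturated_designs_by_region graph_rep_path_designs[symmetric]
    using path_designs_subset inj_on_graph_rep by (auto simp: inj_on_def)
  show "?N = path_design ` {\<sigma>. \<sigma> permutes {1..4}}"
    unfolding saturated_designs_by_region path_design_image ..
  have standard: "path_edges 1 2 3 4 = {(1,2), (2,3), (3,4)}" "{1, 2, 3, 4} = {1..4::nat}"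
    by (auto simp: path_edges_def ordered_pair_def numeral_eq_Suc)
  show "optimality_region (design_on {(1,2), (2,3), (3,4)}) =
        {\<beta>. let l = intensity \<beta> in
          l 1 3 * (l 1 2 + l 2 3) - l 1 2 * l 2 3 \<le> 0
          \<and> l 2 4 * (l 2 3 + l 3 4) - l 2 3 * l 3 4 \<le> 0
          \<and> l 1 4 * (l 1 2 * l 2 3 + l 1 2 * l 3 4 + l 2 3 * l 3 4) - l 1 2 * l 2 3 * l 3 4 \<le> 0}"
    using optimality_region_path[OF standard(2)] unfolding standard(1) .
  fix \<sigma> :: "nat \<Rightarrow> nat"
  assume perm: "\<sigma> permutes {1..4}"
  show "optimality_region (path_design \<sigma>) =
        {\<beta>. let l = (\<lambda>i j. intensity \<beta> (\<sigma> i) (\<sigma> j)) in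
          l 1 3 * (l 1 2 + l 2 3) - l 1 2 * l 2 3 \<le> 0
          \<and> l 2 4 * (l 2 3 + l 3 4) - l 2 3 * l 3 4 \<le> 0
          \<and> l 1 4 * (l 1 2 * l 2 3 + l 1 2 * l 3 4 + l 2 3 * l 3 4) - l 1 2 * l 2 3 * l 3 4 \<le> 0}"
    unfolding path_design_eq Let_def optimality_region_path[OF permutes_labelling[OF perm]] ..
qed

end
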